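(* For every integer $d\ge 1$ there exist a $2\times 2$ matrix function $A(t)$ whose entries are real polynomials in $t$, with $A$ of degree $2d$ as a matrix polynomial and $\max_{t\in[-1,1]}\|A(t)\|\le 1$, and a solution $x(t)=(x_1(t),x_2(t))$ of the linear system of ordinary differential equations $\dot x=A(t)x$, $x\in\mathbb R^2$, such that the first component $x_1$ has exactly $d$ isolated zeros on $[-1,1]$. Consequently, the number of isolated zeros on $[-1,1]$ of a component of a solution of a linear system $\dot x=A(t)x$ with polynomial coefficient matrix cannot be bounded in terms of $\max_{t\in[-1,1]}\|A(t)\|$: there is no constant $N$ such that, for every $2\times 2$ matrix $A(t)$ with real polynomial entries and $\max_{t\in[-1,1]}\|A(t)\|\le 1$, every component of every solution of $\dot x=A(t)x$ has at most $N$ isolated zeros on $[-1,1]$.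
   Context: The dot denotes $d/dt$. A matrix polynomial $A(t)=\sum_{k=0}^{m}A_kt^k$ with $A_k\in\operatorname{Mat}_{2\times 2}(\mathbb R)$ has degree $m$ if $A_m\ne 0$. For a real $2\times2$ matrix $M$, $\|M\|$ denotes the operator norm induced by the Euclidean norm on $\mathbb R^2$. A zero $t_0\in[-1,1]$ of a function $f$ on $[-1,1]$ is isolated if some neighborhood of $t_0$ in $[-1,1]$ contains no other zero of $f$; zeros are counted as distinct points. *)

theory Defs
  imports "HOL-Analysis.Analysis" "HOL-Computational_Algebra.Polynomial"
begin

(* A matrix polynomial is the library polynomial with coefficients in Mat_{2x2}(R), so its degree is
   the library degree: the largest k with nonzero coefficient A_k.  Evaluation is written out with
   scalar multiplication because the library's poly would use the ring product of the coefficient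
   type, which for the type real^2^2 is not the matrix product. *)
type_synonym mat_poly = "(real^2^2) poly"

definition mat_eval :: "mat_poly \<Rightarrow> real \<Rightarrow> real^2^2" where
  "mat_eval A t = (\<Sum>k\<le>degree A. t ^ k *\<^sub>R coeff A k)"

(* The operator norm induced by the Euclidean norm, which is the norm of the type real^2;
   the norm of the type real^2^2 is the Frobenius norm. *)
definition op_norm :: "real^2^2 \<Rightarrow> real" where
  "op_norm M = onorm (\<lambda>v. M *v v)"

definition ode_solution :: "mat_poly \<Rightarrow> (real \<Rightarrow> real^2) \<Rightarrow> bool" where
  "ode_solution A x \<longleftrightarrow> (\<forall>t. (x has_vector_derivative mat_eval A t *v x t) (at t))"

definition isolated_zeros :: "(real \<Rightarrow> real) \<Rightarrow> real set" where
  "isolated_zeros f = {t. t isolated_in {s \<in> {-1..1}. f s = 0}}"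

end

theory Submission
  imports Defs
begin

text \<open>
  A nilpotent coefficient matrix already suffices. If \<open>A(t)\<close> is the strictly upper triangular matrix
  with corner entry \<open>Q'(t)\<close>, then the constant second component \<open>1\<close> turns the system into
  \<open>x\<^sub>1' = Q'\<close>, so that \<open>(Q, 1)\<close> is a solution: any real polynomial \<open>Q\<close> occurs as a first component.
  Multiplying \<open>Q\<close> by a small positive constant makes the norm of \<open>A\<close> on the compact interval
  at most \<open>1\<close> and moves neither the zeros nor the degree (lemma \<open>polynomial_component_realizable\<close>).
  It remains to choose a polynomial of degree \<open>2d + 1\<close> with exactly \<open>d\<close> distinct zeros in
  \<open>[-1, 1]\<close>: put \<open>d\<close> simple zeros inside and one zero of multiplicity \<open>d + 1\<close> outside.
  Since \<open>d\<close> is arbitrary while the norm bound stays \<open>1\<close>, no bound in terms of the norm exists.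
\<close>

definition corner :: "real \<Rightarrow> real^2^2" where
  "corner c = (\<chi> i j. if i = 1 \<and> j = 2 then c else 0)"

lemma corner_0 [simp]: "corner 0 = 0"
  by (simp add: corner_def vec_eq_iff)

lemma corner_eq_0_iff [simp]: "corner c = 0 \<longleftrightarrow> c = 0"
  by (auto simp: corner_def vec_eq_iff)

lemma corner_mult_vec: "corner c *v v = (c * v $ 2) *\<^sub>R axis 1 1"
  by (simp add: corner_def vec_eq_iff forall_2 matrix_vector_mult_def sum_2 axis_def)

lemma op_norm_corner_le: "op_norm (corner c) \<le> \<bar>c\<bar>"
  unfolding op_norm_def
proof (rule onorm_le)
  fix v :: "real^2"
  have "norm (corner c *v v) = \<bar>c\<bar> * \<bar>v $ 2\<bar>"
    by (simp add: corner_mult_vec abs_mult)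
  also have "\<dots> \<le> \<bar>c\<bar> * norm v"
    by (intro mult_left_mono component_le_norm_cart) simp
  finally show "norm (corner c *v v) \<le> \<bar>c\<bar> * norm v" .
qed

lemma degree_map_poly_corner: "degree (map_poly corner p) = degree p"
  by (rule degree_map_poly) simp

lemma mat_eval_map_poly_corner: "mat_eval (map_poly corner p) t = corner (poly p t)"
proof -
  have "mat_eval (map_poly corner p) t = (\<Sum>k\<le>degree p. t ^ k *\<^sub>R corner (coeff p k))"
    by (simp add: mat_eval_def degree_map_poly_corner coeff_map_poly)
  also have "\<dots> = corner (\<Sum>k\<le>degree p. t ^ k * coeff p k)"
    by (auto simp: vec_eq_iff corner_def intro!: sum.neutral)
  also have "\<dots> = corner (poly p t)"
    by (simp add: poly_altdef mult.commute)
  finally show ?thesis .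
qed

lemma ode_solution_corner:
  "ode_solution (map_poly corner (pderiv q)) (\<lambda>t. poly q t *\<^sub>R axis 1 1 + axis 2 1)"
  unfolding ode_solution_def mat_eval_map_poly_corner corner_mult_vec
  by (auto intro!: derivative_eq_intros poly_DERIV simp: axis_def)

text \<open>A nonzero polynomial has finitely many zeros, which are therefore all isolated.\<close>

lemma isolated_zeros_poly:
  assumes "p \<noteq> 0"
  shows "isolated_zeros (poly p) = {t \<in> {-1..1}. poly p t = 0}"
proof -
  have "finite {t \<in> {-1..1}. poly p t = 0}"
    by (rule finite_subset[OF _ poly_roots_finite[OF assms]]) auto
  then show ?thesis
    by (auto simp: isolated_zeros_def isolated_in_islimpt_iff islimpt_finite)
qed

text \<open>
  Boundedness of \<open>p'\<close> on \<open>[-1, 1]\<close> is all that the norm condition costs: rescaling \<open>p\<close> by the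
  inverse of such a bound keeps its zero set.
\<close>

lemma polynomial_component_realizable:
  fixes p :: "real poly"
  assumes "p \<noteq> 0"
  shows "\<exists>(A::mat_poly) x. degree A = degree p - 1 \<and>
           (\<forall>t\<in>{-1..1}. op_norm (mat_eval A t) \<le> 1) \<and> ode_solution A x \<and>
           isolated_zeros (\<lambda>t. x t $ 1) = {t \<in> {-1..1}. poly p t = 0}"
proof -
  have "compact (poly (pderiv p) ` {-1..1})"
    by (intro compact_continuous_image continuous_intros) simp
  then obtain B where B: "B > 0" "\<And>t. t \<in> {-1..1} \<Longrightarrow> \<bar>poly (pderiv p) t\<bar> \<le> B"
    by (auto dest!: compact_imp_bounded simp: bounded_pos)
  define q where "q = smult (1 / B) p"
  define A where "A = map_poly corner (pderiv q)"
  define x :: "real \<Rightarrow> real^2" where "x = (\<lambda>t. poly q t *\<^sub>R axis 1 1 + axis 2 1)"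
  have "q \<noteq> 0"
    using assms B(1) by (simp add: q_def)
  have "degree A = degree p - 1"
    using B(1) by (simp add: A_def degree_map_poly_corner degree_pderiv q_def)
  moreover have "op_norm (mat_eval A t) \<le> 1" if "t \<in> {-1..1}" for t
  proof -
    have "op_norm (mat_eval A t) \<le> \<bar>poly (pderiv q) t\<bar>"
      unfolding A_def mat_eval_map_poly_corner by (rule op_norm_corner_le)
    also have "\<dots> \<le> 1"
      using B(1) B(2)[OF that] by (simp add: q_def pderiv_smult abs_mult field_simps)
    finally show ?thesis .
  qed
  moreover have "ode_solution A x"
    unfolding A_def x_def by (rule ode_solution_corner)
  moreover have "(\<lambda>t. x t $ 1) = poly q"
    by (simp add: x_def axis_def fun_eq_iff)
  then have "isolated_zeros (\<lambda>t. x t $ 1) = {t \<in> {-1..1}. poly p t = 0}"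
    using isolated_zeros_poly[OF \<open>q \<noteq> 0\<close>] B(1) by (simp add: q_def)
  ultimately show ?thesis
    by blast
qed

lemma exists_poly_with_d_zeros:
  "\<exists>p::real poly. degree p = 2 * d + 1 \<and> p \<noteq> 0 \<and> card {t \<in> {-1..1}. poly p t = 0} = d"
proof -
  define r :: "nat \<Rightarrow> real" where "r i = 1 / (real i + 1)" for i
  define p where "p = (\<Prod>i<d. [:- r i, 1:]) * [:-2, 1:] ^ (d + 1)"
  have "degree (\<Prod>i<d. [:- r i, 1:]) = d"
    by (subst degree_prod_eq_sum_degree) auto
  then have "degree p = 2 * d + 1"
    unfolding p_def by (subst degree_mult_eq) (auto simp: degree_power_eq simp del: power_Suc)
  moreover have "{t \<in> {-1..1}. poly p t = 0} = r ` {..<d}"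
  proof -
    have "r i \<in> {-1..1}" for i
      by (simp add: r_def field_simps)
    then show ?thesis
      by (auto simp: p_def poly_prod)
  qed
  moreover have "inj_on r {..<d}"
    by (auto simp: inj_on_def r_def)
  ultimately show ?thesis
    by (intro exI[of _ p]) (auto simp: card_image)
qed

theorem mainTheorem1:
  shows "(\<forall>d::nat. d \<ge> 1 \<longrightarrow>
            (\<exists>(A::mat_poly) x.
               degree A = 2 * d \<and>
               (\<forall>t\<in>{-1..1}. op_norm (mat_eval A t) \<le> 1) \<and>
               ode_solution A x \<and>
               finite (isolated_zeros (\<lambda>t. x t $ 1)) \<and>
               card (isolated_zeros (\<lambda>t. x t $ 1)) = d))
       \<and> \<not> (\<exists>N::nat. \<forall>A::mat_poly.
               (\<forall>t\<in>{-1..1}. op_norm (mat_eval A t) \<le> 1) \<longrightarrow>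
               (\<forall>x. ode_solution A x \<longrightarrow>
                 (\<forall>i. finite (isolated_zeros (\<lambda>t. x t $ i)) \<and>
                      card (isolated_zeros (\<lambda>t. x t $ i)) \<le> N)))"
proof -
  have real: "\<exists>(A::mat_poly) x.
               degree A = 2 * d \<and>
               (\<forall>t\<in>{-1..1}. op_norm (mat_eval A t) \<le> 1) \<and>
               ode_solution A x \<and>
               finite (isolated_zeros (\<lambda>t. x t $ 1)) \<and>
               card (isolated_zeros (\<lambda>t. x t $ 1)) = d" for d
  proof -
    obtain p :: "real poly" where p: "degree p = 2 * d + 1" "p \<noteq> 0"
        "card {t \<in> {-1..1}. poly p t = 0} = d"
      using exists_poly_with_d_zeros by blast
    have "finite {t \<in> {-1..1}. poly p t = 0}"
      by (rule finite_subset[OF _ poly_roots_finite[OF p(2)]]) auto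
    with polynomial_component_realizable[OF p(2)] p(1,3) show ?thesis
      by (metis add_diff_cancel_right')
  qed
  show ?thesis
  proof (intro conjI allI impI notI)
    fix d :: nat
    show "\<exists>(A::mat_poly) x.
               degree A = 2 * d \<and>
               (\<forall>t\<in>{-1..1}. op_norm (mat_eval A t) \<le> 1) \<and>
               ode_solution A x \<and>
               finite (isolated_zeros (\<lambda>t. x t $ 1)) \<and>
               card (isolated_zeros (\<lambda>t. x t $ 1)) = d"
      by (rule real)
  next
    assume "\<exists>N::nat. \<forall>A::mat_poly.
               (\<forall>t\<in>{-1..1}. op_norm (mat_eval A t) \<le> 1) \<longrightarrow>
               (\<forall>x. ode_solution A x \<longrightarrow>
                 (\<forall>i. finite (isolated_zeros (\<lambda>t. x t $ i)) \<and>
                      card (isolated_zeros (\<lambda>t. x t $ i)) \<le> N))"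
    then obtain N :: nat where N: "card (isolated_zeros (\<lambda>t. x t $ i)) \<le> N"
      if "\<forall>t\<in>{-1..1}. op_norm (mat_eval A t) \<le> 1" "ode_solution A x" for A x i
      by blast
    from real[of "Suc N"] show False
      using N by (metis not_less_eq_eq order_refl)
  qed
qed

end
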